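(* Let $(E,sim,ser)$ be a comtrace alphabet. A step sequence $u\in\mathbb{S}^*$ is maximally concurrent if and only if it is canonical.
   Context: A comtrace alphabet is $(E,sim,ser)$ with $E$ finite, $sim\subseteq E\times E$ irreflexive and symmetric, $ser\subseteq sim$. Steps $\mathbb{S}$: nonempty $A\subseteq E$ with $(a,b)\in sim$ for all distinct $a,b\in A$. The comtrace congruence $\equiv$ on $\mathbb{S}^*$ is the reflexive symmetric transitive closure of the pairs $(wAz,wBCz)$ with $A,B,C\in\mathbb{S}$, $A=B\cup C$, $B\times C\subseteq ser$. For $x=A_1\dots A_k$, $\mathrm{length}(x)=k$; $A_i$ is maximally concurrent in $x$ iff for all $B\in\mathbb{S},y\in\mathbb{S}^*$, $By\equiv A_i\dots A_k\Rightarrow|B|\le|A_i|$; $mc(x)$ is the smallest $i$ such that $A_i$ is maximally concurrent in $x$. A step sequence $u=A_1\dots A_k$ is maximally concurrent iff (1) $v\equiv u\Rightarrow\mathrm{length}(u)\le\mathrm{length}(v)$ for all $v$, and (2) for all $i=1,\dots,k$ and all $w$, with $u_i=A_i\dots A_k$: $(u_i\equiv w\wedge\mathrm{length}(u_i)=\mathrm{length}(w))\Rightarrow mc(u_i)\le mc(w)$. The forward dependency $\mathbb{FD}$ consists of pairs of steps $(A,B)$ for which there is $C\in\mathbb{S}$ with $C\subseteq B$, $A\times C\subseteq ser$, $C\times(B\setminus C)\subseteq ser$; $A_1\dots A_k$ is canonical iff $(A_i,A_{i+1})\notin\mathbb{FD}$ for all $1\le i<k$. *)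

theory Defs
  imports Main
begin

locale comtrace_alphabet =
  fixes E :: "'a set" and sim ser :: "('a \<times> 'a) set"
  assumes finite_events: "finite E"
    and sim_subset: "sim \<subseteq> E \<times> E"
    and irrefl_sim: "irrefl sim"
    and sym_sim: "sym sim"
    and ser_subset: "ser \<subseteq> sim"
begin

definition steps :: "'a set set" where
  "steps = {A. A \<noteq> {} \<and> A \<subseteq> E \<and> (\<forall>a\<in>A. \<forall>b\<in>A. a \<noteq> b \<longrightarrow> (a, b) \<in> sim)}"

abbreviation step_seqs :: "'a set list set" where
  "step_seqs \<equiv> lists steps"

definition elem_cong :: "('a set list \<times> 'a set list) set" where
  "elem_cong = {(w @ [A] @ z, w @ [B, C] @ z) | w z A B C.
     w \<in> step_seqs \<and> z \<in> step_seqs \<and> A \<in> steps \<and> B \<in> steps \<and> C \<in> steps \<and>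
     A = B \<union> C \<and> B \<times> C \<subseteq> ser}"

(* As a relation on all lists this also relates every list outside step_seqs to itself,
   and to nothing else; all uses below are restricted to step_seqs. *)
definition comtrace_cong :: "'a set list \<Rightarrow> 'a set list \<Rightarrow> bool" (infix "\<approx>" 50) where
  "x \<approx> y \<longleftrightarrow> (x, y) \<in> (elem_cong \<union> elem_cong\<inverse>)\<^sup>*"

(* Positions are counted from 1: the i-th step of x is x ! (i - 1), and
   A_i ... A_k is drop (i - 1) x. *)
definition max_conc_at :: "'a set list \<Rightarrow> nat \<Rightarrow> bool" where
  "max_conc_at x i \<longleftrightarrow>
     (\<forall>B\<in>steps. \<forall>y\<in>step_seqs. B # y \<approx> drop (i - 1) x \<longrightarrow> card B \<le> card (x ! (i - 1)))"

(* Such an i exists for every nonempty step sequence (the last position qualifies);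
   the value for the empty sequence is unspecified and never used. *)
definition mc :: "'a set list \<Rightarrow> nat" where
  "mc x = (LEAST i. 1 \<le> i \<and> i \<le> length x \<and> max_conc_at x i)"

definition maximally_concurrent :: "'a set list \<Rightarrow> bool" where
  "maximally_concurrent u \<longleftrightarrow>
     (\<forall>v\<in>step_seqs. v \<approx> u \<longrightarrow> length u \<le> length v) \<and>
     (\<forall>i\<in>{1..length u}. \<forall>w\<in>step_seqs.
        drop (i - 1) u \<approx> w \<and> length (drop (i - 1) u) = length w \<longrightarrow>
        mc (drop (i - 1) u) \<le> mc w)"

definition forward_dep :: "('a set \<times> 'a set) set" where
  "forward_dep = {(A, B). A \<in> steps \<and> B \<in> steps \<and>
     (\<exists>C\<in>steps. C \<subseteq> B \<and> A \<times> C \<subseteq> ser \<and> C \<times> (B - C) \<subseteq> ser)}"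

definition canonical :: "'a set list \<Rightarrow> bool" where
  "canonical u \<longleftrightarrow> (\<forall>i. 1 \<le> i \<and> i < length u \<longrightarrow> (u ! (i - 1), u ! i) \<notin> forward_dep)"

end

end

theory Submission
  imports Defs "HOL-Library.Confluence"
begin

text \<open>
  Orient the congruence as a rewriting system: if \<open>C\<close> witnesses \<open>(A, B) \<in> FD\<close>, rewrite the
  neighbouring steps \<open>A B\<close> to \<open>(A \<union> C) (B - C)\<close>, dropping the second step if it is empty. These
  rules generate the congruence, their normal forms are the canonical sequences, and they terminate
  and are locally confluent. By Newman's lemma a canonical \<open>u\<close> is the normal form of every
  sequence congruent to it. As rewriting never lengthens a sequence and only enlarges its
  first step, \<open>u\<close> has minimal length and its first step has maximal cardinality; the same holds for
  every suffix. Conversely, comparing the suffixes of a maximally concurrent sequence with their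
  normal forms shows that each of its steps is of maximal cardinality, while a pair in \<open>FD\<close>
  would allow one of them to be enlarged.
\<close>

section \<open>Newman's lemma\<close>

text \<open>Well-founded induction on the common source \<open>x\<close>. The first rewrites of both
  paths are joined at \<open>u\<close> by local confluence; the hypothesis at \<open>y1\<close>
  joins \<open>y\<close> with \<open>u\<close> at some \<open>v\<close>, and the one at
  \<open>z1\<close> then joins \<open>z\<close> with \<open>v\<close>.\<close>

lemma newman:
  assumes wf: "wfP r\<inverse>\<inverse>"
    and local: "\<And>x y z. r x y \<Longrightarrow> r x z \<Longrightarrow> \<exists>u. r\<^sup>*\<^sup>* y u \<and> r\<^sup>*\<^sup>* z u"
  shows "confluentp r"
proof (rule confluentpI)
  fix x y z
  assume "r\<^sup>*\<^sup>* x y" "r\<^sup>*\<^sup>* x z"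
  with wf show "\<exists>u. r\<^sup>*\<^sup>* y u \<and> r\<^sup>*\<^sup>* z u"
  proof (induction x arbitrary: y z rule: wfp_induct_rule)
    case (less x)
    show ?case
    proof (cases "x = y \<or> x = z")
      case True
      with less.prems show ?thesis by blast
    next
      case False
      with less.prems obtain y1 z1 where y1: "r x y1" "r\<^sup>*\<^sup>* y1 y" and z1: "r x z1" "r\<^sup>*\<^sup>* z1 z"
        by (metis converse_rtranclpE)
      from local[OF y1(1) z1(1)] obtain u where u: "r\<^sup>*\<^sup>* y1 u" "r\<^sup>*\<^sup>* z1 u" by blast
      from less.IH[of y1 y u] y1 u obtain v where v: "r\<^sup>*\<^sup>* y v" "r\<^sup>*\<^sup>* u v" by auto
      have "r\<^sup>*\<^sup>* z1 v" using u(2) v(2) by (rule rtranclp_trans)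
      with less.IH[of z1 z v] z1 obtain t where "r\<^sup>*\<^sup>* z t" "r\<^sup>*\<^sup>* v t" by auto
      with v(1) show ?thesis by (blast intro: rtranclp_trans)
    qed
  qed
qed

context comtrace_alphabet
begin

section \<open>The rewriting system\<close>

text \<open>Steps are nonempty, so a remainder \<open>B - C\<close> that has become empty must
  vanish from the sequence.\<close>

definition attach :: "'a set \<Rightarrow> 'a set list \<Rightarrow> 'a set list" where
  "attach D z = (if D = {} then z else D # z)"

text \<open>The premises on \<open>A\<close>, \<open>B\<close>, \<open>C\<close> in
  \<open>head\<close> say that \<open>C\<close> witnesses \<open>(A, B) \<in> forward_dep\<close>.
  The right context \<open>z\<close> is built into \<open>head\<close>; \<open>tail\<close> supplies
  the left one.\<close>

inductive merge :: "'a set list \<Rightarrow> 'a set list \<Rightarrow> bool" where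
  head: "\<lbrakk>A \<in> steps; B \<in> steps; C \<in> steps; C \<subseteq> B; A \<times> C \<subseteq> ser; C \<times> (B - C) \<subseteq> ser; z \<in> step_seqs\<rbrakk>
    \<Longrightarrow> merge (A # B # z) ((A \<union> C) # attach (B - C) z)"
| tail: "\<lbrakk>A \<in> steps; merge x y\<rbrakk> \<Longrightarrow> merge (A # x) (A # y)"

inductive_cases merge_NilE: "merge [] y"

inductive_cases merge_ConsE: "merge (A # x) y"

lemma step_nonempty: "A \<in> steps \<Longrightarrow> A \<noteq> {}"
  by (simp add: steps_def)

lemma finite_step: "A \<in> steps \<Longrightarrow> finite A"
  using finite_events by (auto simp: steps_def intro: finite_subset)

lemma step_subset: "\<lbrakk>A \<in> steps; B \<subseteq> A; B \<noteq> {}\<rbrakk> \<Longrightarrow> B \<in> steps"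
  unfolding steps_def by blast

lemma ser_disjoint: "A \<times> C \<subseteq> ser \<Longrightarrow> A \<inter> C = {}"
  using irrefl_sim ser_subset by (auto simp: irrefl_def)

lemma step_union: "\<lbrakk>A \<in> steps; C \<in> steps; A \<times> C \<subseteq> ser\<rbrakk> \<Longrightarrow> A \<union> C \<in> steps"
  using ser_subset sym_sim unfolding steps_def sym_def by auto

lemma attach_step_seqs:
  "\<lbrakk>B \<in> steps; z \<in> step_seqs\<rbrakk> \<Longrightarrow> attach (B - C) z \<in> step_seqs"
  by (auto simp: attach_def intro: step_subset)

lemma merge_step_seqs: "merge x y \<Longrightarrow> x \<in> step_seqs \<and> y \<in> step_seqs"
  by (induction rule: merge.induct) (auto simp: step_union attach_step_seqs)

lemma merge_rtranclp_Cons: "merge\<^sup>*\<^sup>* x y \<Longrightarrow> A \<in> steps \<Longrightarrow> merge\<^sup>*\<^sup>* (A # x) (A # y)"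
  by (induction rule: rtranclp_induct) (auto intro: merge.tail rtranclp.rtrancl_into_rtrancl)

lemma merge_attach: "\<lbrakk>B \<in> steps; merge x y\<rbrakk> \<Longrightarrow> merge (attach (B - C) x) (attach (B - C) y)"
  by (auto simp: attach_def intro: merge.tail step_subset)

text \<open>With an empty \<open>C\<close> no rewrite takes place. Admitting this case helps with
  critical pairs, where what is left of a witness may be empty.\<close>

lemma merge_rtranclp_head:
  assumes "A \<in> steps" "B \<in> steps" "C \<subseteq> B" "A \<times> C \<subseteq> ser" "C \<times> (B - C) \<subseteq> ser" "z \<in> step_seqs"
  shows "merge\<^sup>*\<^sup>* (A # B # z) ((A \<union> C) # attach (B - C) z)"
proof (cases "C = {}")
  case True
  with assms show ?thesis by (simp add: attach_def step_nonempty)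
next
  case False
  with assms show ?thesis by (blast intro: merge.head step_subset)
qed

section \<open>Local confluence\<close>

text \<open>One half of the critical pair given by two witnesses for the same \<open>A B\<close>:
  once \<open>C\<close> has moved, the rest \<open>C' - C\<close> can follow. The other half arises
  by exchanging \<open>C\<close> and \<open>C'\<close>.\<close>

lemma merge_head_head:
  assumes st: "A \<in> steps" "B \<in> steps" "C \<in> steps" "C' \<in> steps" and z: "z \<in> step_seqs"
    and C: "C \<subseteq> B" "A \<times> C \<subseteq> ser" "C \<times> (B - C) \<subseteq> ser"
    and C': "C' \<subseteq> B" "A \<times> C' \<subseteq> ser" "C' \<times> (B - C') \<subseteq> ser"
  shows "merge\<^sup>*\<^sup>* ((A \<union> C) # attach (B - C) z) ((A \<union> (C \<union> C')) # attach (B - (C \<union> C')) z)"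
proof (cases "B - C = {}")
  case True
  with C' C have "C \<union> C' = C" "B - (C \<union> C') = B - C" by auto
  then show ?thesis by simp
next
  case False
  \<comment> \<open>The part from \<open>C\<close> holds because \<open>C' - C\<close> lies in
    \<open>B - C\<close>.\<close>
  have "(A \<union> C) \<times> (C' - C) \<subseteq> ser" using C C' by blast
  moreover have "(C' - C) \<times> ((B - C) - (C' - C)) \<subseteq> ser" using C' by blast
  ultimately have "merge\<^sup>*\<^sup>* ((A \<union> C) # (B - C) # z)
      ((A \<union> C \<union> (C' - C)) # attach (B - C - (C' - C)) z)"
    using False st C C' z by (intro merge_rtranclp_head) (auto intro: step_union step_subset)
  moreover have "A \<union> C \<union> (C' - C) = A \<union> (C \<union> C')" "B - C - (C' - C) = B - (C \<union> C')" by auto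
  ultimately show ?thesis using False by (simp add: attach_def)
qed

text \<open>The critical pair in which \<open>C\<close> leaves \<open>B\<close> while
  \<open>F\<close> enters it. Since \<open>C \<times> F\<close> lies in \<open>B \<times> F\<close>,
  \<open>C\<close> can still leave \<open>B \<union> F\<close>; if \<open>B - C\<close> is nonempty,
  both sides meet in \<open>A \<union> C\<close>, \<open>B - C \<union> F\<close>,
  \<open>D - F\<close>.\<close>

lemma merge_overlap:
  assumes st: "A \<in> steps" "B \<in> steps" "C \<in> steps" "D \<in> steps" "F \<in> steps" and z: "z \<in> step_seqs"
    and C: "C \<subseteq> B" "A \<times> C \<subseteq> ser" "C \<times> (B - C) \<subseteq> ser"
    and F: "F \<subseteq> D" "B \<times> F \<subseteq> ser" "F \<times> (D - F) \<subseteq> ser"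
  shows "\<exists>u. merge\<^sup>*\<^sup>* ((A \<union> C) # attach (B - C) (D # z)) u \<and>
             merge\<^sup>*\<^sup>* (A # (B \<union> F) # attach (D - F) z) u"
proof -
  have disj: "B \<inter> F = {}" using F(2) by (rule ser_disjoint)
  have AC: "A \<union> C \<in> steps" using st C by (blast intro: step_union)
  have BF: "B \<union> F \<in> steps" using st F by (blast intro: step_union)
  have zD: "attach (D - F) z \<in> step_seqs" using st z by (simp add: attach_step_seqs)
  have "C \<times> (B \<union> F - C) \<subseteq> ser" using C F by blast
  then have second: "merge\<^sup>*\<^sup>* (A # (B \<union> F) # attach (D - F) z)
      ((A \<union> C) # attach (B \<union> F - C) (attach (D - F) z))"
    using st C BF zD by (intro merge_rtranclp_head) auto
  have ne: "B \<union> F - C = (B - C) \<union> F" "(B - C) \<union> F \<noteq> {}"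
    using disj C step_nonempty[OF \<open>F \<in> steps\<close>] by auto
  show ?thesis
  proof (cases "B - C = {}")
    \<comment> \<open>\<open>B\<close> has moved entirely, so on one side \<open>F\<close> has no
      partner to join. The other side is rewritten further instead: \<open>F\<close> absorbs
      \<open>D - F\<close>, which restores \<open>D\<close>.\<close>
    case True
    have "merge\<^sup>*\<^sup>* (F # attach (D - F) z) (D # z)"
    proof (cases "D - F = {}")
      case True
      with F have "F = D" by auto
      then show ?thesis by (simp add: attach_def)
    next
      case False
      then have "merge\<^sup>*\<^sup>* (F # (D - F) # z) ((F \<union> (D - F)) # attach (D - F - (D - F)) z)"
        using st F z by (intro merge_rtranclp_head) (auto intro: step_subset)
      moreover have "F \<union> (D - F) = D" using F by auto
      ultimately show ?thesis using False by (simp add: attach_def)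
    qed
    then have "merge\<^sup>*\<^sup>* ((A \<union> C) # F # attach (D - F) z) ((A \<union> C) # D # z)"
      using AC by (rule merge_rtranclp_Cons)
    moreover have "B - C \<union> F = F" using True by auto
    then have "attach (B \<union> F - C) (attach (D - F) z) = F # attach (D - F) z"
      using ne by (simp add: attach_def)
    moreover have "attach (B - C) (D # z) = D # z" using True by (simp add: attach_def)
    ultimately show ?thesis using second by (metis rtranclp.rtrancl_refl rtranclp_trans)
  next
    case False
    have "merge\<^sup>*\<^sup>* ((B - C) # D # z) ((B - C \<union> F) # attach (D - F) z)"
      using False st F z by (intro merge_rtranclp_head) (auto intro: step_subset)
    then have "merge\<^sup>*\<^sup>* ((A \<union> C) # (B - C) # D # z) ((A \<union> C) # (B - C \<union> F) # attach (D - F) z)"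
      using AC by (rule merge_rtranclp_Cons)
    moreover have "attach (B \<union> F - C) (attach (D - F) z) = (B - C \<union> F) # attach (D - F) z"
      using ne by (simp add: attach_def)
    moreover have "attach (B - C) (D # z) = (B - C) # D # z" using False by (simp add: attach_def)
    ultimately show ?thesis using second by metis
  qed
qed

text \<open>The place of the second rewrite decides: at the same pair two witnesses compete, one
  place later the redexes overlap in \<open>B\<close>, and further right they are disjoint and the
  rewrites commute.\<close>

lemma merge_head_local_confluence:
  assumes st: "A \<in> steps" "B \<in> steps" "C \<in> steps" and z: "z \<in> step_seqs"
    and C: "C \<subseteq> B" "A \<times> C \<subseteq> ser" "C \<times> (B - C) \<subseteq> ser"
    and y: "merge (A # B # z) y"
  shows "\<exists>u. merge\<^sup>*\<^sup>* ((A \<union> C) # attach (B - C) z) u \<and> merge\<^sup>*\<^sup>* y u"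
  using y
proof cases
  case (head C')
  have "merge\<^sup>*\<^sup>* y ((A \<union> (C \<union> C')) # attach (B - (C \<union> C')) z)"
    using merge_head_head[of A B C' C z] st C z head by (simp add: Un_commute)
  moreover have "merge\<^sup>*\<^sup>* ((A \<union> C) # attach (B - C) z) ((A \<union> (C \<union> C')) # attach (B - (C \<union> C')) z)"
    using merge_head_head[of A B C C' z] st C z head by simp
  ultimately show ?thesis by blast
next
  case (tail y')
  from tail(3) show ?thesis
  proof cases
    case (head D F z')
    then show ?thesis using merge_overlap[of A B C D F z'] st C tail(1) by simp
  next
    case (tail z')
    have "A \<union> C \<in> steps" using st C by (blast intro: step_union)
    then have "merge ((A \<union> C) # attach (B - C) z) ((A \<union> C) # attach (B - C) z')"
      using tail by (intro merge.tail merge_attach) auto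
    moreover have "merge (A # B # z') ((A \<union> C) # attach (B - C) z')"
      using tail st C merge_step_seqs by (blast intro: merge.head)
    ultimately show ?thesis using tail \<open>y = A # y'\<close> by blast
  qed
qed

lemma merge_local_confluence:
  "merge x y \<Longrightarrow> merge x z \<Longrightarrow> \<exists>u. merge\<^sup>*\<^sup>* y u \<and> merge\<^sup>*\<^sup>* z u"
proof (induction arbitrary: z rule: merge.induct)
  case (head A B C x)
  then show ?case by (intro merge_head_local_confluence)
next
  case (tail A x y)
  from tail.prems show ?case
  proof cases
    \<comment> \<open>The given rewrites are exchanged here: the one at the head takes the first
      role in the preceding lemma.\<close>
    case (head B C x')
    have "merge (A # B # x') (A # y)" using tail.hyps head by (auto intro: merge.tail)
    from merge_head_local_confluence[OF _ _ _ _ _ _ _ this, of C] head show ?thesis by blast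
  next
    case (tail x'')
    with tail.IH[of x''] obtain u where "merge\<^sup>*\<^sup>* y u" "merge\<^sup>*\<^sup>* x'' u" by blast
    with tail show ?thesis by (blast intro: merge_rtranclp_Cons)
  qed
qed

section \<open>Termination and confluence\<close>

primrec total :: "'a set list \<Rightarrow> nat" where
  "total [] = 0"
| "total (A # x) = card A + total x"

text \<open>The weight is the sum of the step sizes multiplied by their positions, counted from 0.\<close>

primrec weight :: "'a set list \<Rightarrow> nat" where
  "weight [] = 0"
| "weight (A # x) = weight x + total x"

text \<open>Moving the nonempty \<open>C\<close> one place forward lowers the weight by at least
  \<open>card C\<close>. Preservation of \<open>total\<close> is proved along with it because
  \<open>weight (A # x)\<close> contains \<open>total x\<close>, which the case \<open>tail\<close>
  needs.\<close>

lemma merge_total_weight: "merge x y \<Longrightarrow> total y = total x \<and> weight y < weight x"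
proof (induction rule: merge.induct)
  case (head A B C z)
  have "card (A \<union> C) = card A + card C"
    using head by (intro card_Un_disjoint) (auto simp: finite_step ser_disjoint)
  moreover have "card B = card C + card (B - C)"
    using head by (simp add: card_Diff_subset card_mono finite_step)
  moreover have "card C > 0"
    using head by (simp add: card_gt_0_iff finite_step step_nonempty)
  ultimately show ?case by (cases "B - C = {}") (simp_all add: attach_def del: Diff_eq_empty_iff)
qed simp

lemma wfP_merge: "wfP merge\<inverse>\<inverse>"
  by (rule wfp_if_convertible_to_nat[of _ weight]) (simp add: merge_total_weight)

lemma confluentp_merge: "confluentp merge"
  using wfP_merge merge_local_confluence by (rule newman)

section \<open>Contexts, length and first step under rewriting\<close>

lemma merge_append: "w \<in> step_seqs \<Longrightarrow> merge x y \<Longrightarrow> merge (w @ x) (w @ y)"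
  by (induction w) (auto intro: merge.tail)

lemma merge_length: "merge x y \<Longrightarrow> length y \<le> length x"
  by (induction rule: merge.induct) (auto simp: attach_def)

lemma merge_rtranclp_length: "merge\<^sup>*\<^sup>* x y \<Longrightarrow> length y \<le> length x"
  by (induction rule: rtranclp_induct) (auto dest: merge_length)

lemma merge_rtranclp_hd: "merge\<^sup>*\<^sup>* (A # x) y \<Longrightarrow> \<exists>B z. y = B # z \<and> A \<subseteq> B"
proof (induction rule: rtranclp_induct)
  case (step y z)
  then obtain B y' where y: "y = B # y'" and AB: "A \<subseteq> B" by blast
  from step(2) show ?case unfolding y by cases (use AB in auto)
qed simp

lemma merge_rtranclp_step_seqs: "merge\<^sup>*\<^sup>* x y \<Longrightarrow> x \<in> step_seqs \<Longrightarrow> y \<in> step_seqs"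
  by (induction rule: rtranclp_induct) (auto dest: merge_step_seqs)

section \<open>Rewriting generates the congruence\<close>

text \<open>Fusing \<open>B C\<close> into \<open>B \<union> C\<close> is the rewrite whose witness
  is the whole second step, leaving the empty remainder \<open>C - C\<close>.\<close>

lemma elem_cong_merge: "(x, y) \<in> elem_cong \<Longrightarrow> merge y x"
proof -
  assume "(x, y) \<in> elem_cong"
  then obtain w z B C where *: "w \<in> step_seqs" "z \<in> step_seqs" "B \<in> steps" "C \<in> steps"
      "B \<times> C \<subseteq> ser" and xy: "x = w @ [B \<union> C] @ z" "y = w @ [B, C] @ z"
    unfolding elem_cong_def by blast
  then have "merge (B # C # z) ((B \<union> C) # attach (C - C) z)" by (intro merge.head) auto
  from merge_append[OF *(1) this] show "merge y x"
    by (simp add: attach_def xy)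
qed

lemma elem_congI:
  "\<lbrakk>B \<in> steps; C \<in> steps; B \<times> C \<subseteq> ser; w \<in> step_seqs; z \<in> step_seqs\<rbrakk>
    \<Longrightarrow> (w @ (B \<union> C) # z, w @ B # C # z) \<in> elem_cong"
  unfolding elem_cong_def
  by (intro CollectI exI[of _ w] exI[of _ z] exI[of _ "B \<union> C"] exI[of _ B] exI[of _ C])
    (simp add: step_union)

lemma cong_refl: "x \<approx> x"
  by (simp add: comtrace_cong_def)

lemma cong_trans: "x \<approx> y \<Longrightarrow> y \<approx> z \<Longrightarrow> x \<approx> z"
  unfolding comtrace_cong_def by (rule rtrancl_trans)

lemma cong_sym: "x \<approx> y \<Longrightarrow> y \<approx> x"
  unfolding comtrace_cong_def by (rule symD[OF sym_rtrancl[OF sym_Un_converse]])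

lemma elem_cong_Cons:
  assumes "A \<in> steps" "(x, y) \<in> elem_cong"
  shows "(A # x, A # y) \<in> elem_cong"
proof -
  from assms(2) obtain w z B C where
    *: "x = w @ (B \<union> C) # z" "y = w @ B # C # z" "w \<in> step_seqs" "z \<in> step_seqs"
       "B \<in> steps" "C \<in> steps" "B \<times> C \<subseteq> ser"
    unfolding elem_cong_def by auto
  have "A # w \<in> step_seqs" using assms(1) *(3) by simp
  from elem_congI[OF *(5-7) this *(4)] show ?thesis by (simp add: *(1,2))
qed

lemma cong_Cons:
  assumes "A \<in> steps"
  shows "x \<approx> y \<Longrightarrow> A # x \<approx> A # y"
  unfolding comtrace_cong_def
proof (induction rule: rtrancl_induct)
  case (step y z)
  then have "(A # y, A # z) \<in> elem_cong \<union> elem_cong\<inverse>"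
    using elem_cong_Cons[OF assms] by blast
  with step.IH show ?case by (rule rtrancl_into_rtrancl)
qed simp

lemma cong_append: "w \<in> step_seqs \<Longrightarrow> x \<approx> y \<Longrightarrow> w @ x \<approx> w @ y"
  by (induction w) (auto intro: cong_Cons)

text \<open>A rewrite is a split followed by a fusion: \<open>B\<close> is split into
  \<open>C\<close> and \<open>B - C\<close>, then \<open>A\<close> and \<open>C\<close> are
  fused.\<close>

lemma merge_cong: "merge x y \<Longrightarrow> x \<approx> y"
proof (induction rule: merge.induct)
  case (head A B C z)
  have zB: "attach (B - C) z \<in> step_seqs" using head by (simp add: attach_step_seqs)
  have "A # B # z \<approx> A # C # attach (B - C) z"
  proof (cases "B - C = {}")
    case True
    with head have "B = C" by auto
    then show ?thesis by (simp add: attach_def cong_refl)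
  next
    case False
    have "C \<union> (B - C) = B" using head by auto
    moreover have "B - C \<in> steps" using False head by (blast intro: step_subset)
    ultimately have "([A] @ B # z, [A] @ C # (B - C) # z) \<in> elem_cong"
      using head elem_congI[of C "B - C" "[A]" z] by simp
    with False show ?thesis
      by (simp add: attach_def comtrace_cong_def r_into_rtrancl)
  qed
  also have "A # C # attach (B - C) z \<approx> (A \<union> C) # attach (B - C) z"
    using elem_congI[of A C "[]" "attach (B - C) z"] head zB
    by (simp add: comtrace_cong_def r_into_rtrancl)
  finally (cong_trans) show ?case .
qed (rule cong_Cons)

lemma merge_rtranclp_cong: "merge\<^sup>*\<^sup>* x y \<Longrightarrow> x \<approx> y"
  by (induction rule: rtranclp_induct) (rule cong_refl, blast intro: cong_trans merge_cong)

text \<open>The Church-Rosser property: congruence is contained in the equivalence closure of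
  \<open>merge\<close>, and confluence replaces any zigzag of rewrites by a common reduct.\<close>

lemma cong_joinable: "x \<approx> y \<Longrightarrow> \<exists>u. merge\<^sup>*\<^sup>* x u \<and> merge\<^sup>*\<^sup>* y u"
proof -
  assume "x \<approx> y"
  then have "equivclp merge x y"
    unfolding comtrace_cong_def
    by (induction rule: rtrancl_induct) (auto 4 3 dest: elem_cong_merge elim: equivclp_into_equivclp)
  then show ?thesis
    using semiconfluentp_equivclp[OF confluentp_imp_semiconfluentp[OF confluentp_merge]]
    by (auto simp: rtranclp_conversep)
qed

section \<open>Canonical sequences as normal forms\<close>

text \<open>The witness is nonempty and disjoint from \<open>A\<close>, so the first step grows
  strictly; this later contradicts maximal cardinality.\<close>

lemma forward_dep_merge:
  assumes "(A, B) \<in> forward_dep" "z \<in> step_seqs"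
  obtains A' y where "A \<subset> A'" "A' \<in> steps" "y \<in> step_seqs" "merge (A # B # z) (A' # y)"
proof -
  from assms obtain C where C: "A \<in> steps" "B \<in> steps" "C \<in> steps" "C \<subseteq> B" "A \<times> C \<subseteq> ser"
      "C \<times> (B - C) \<subseteq> ser"
    unfolding forward_dep_def by auto
  have "A \<subset> A \<union> C" using ser_disjoint[OF C(5)] step_nonempty[OF C(3)] by auto
  moreover have "merge (A # B # z) ((A \<union> C) # attach (B - C) z)"
    using C assms by (intro merge.head)
  moreover from this have "A \<union> C \<in> steps" "attach (B - C) z \<in> step_seqs"
    by (auto dest: merge_step_seqs)
  ultimately show thesis by (intro that)
qed

lemma canonical_Nil: "canonical []"
  by (simp add: canonical_def)

lemma canonical_single: "canonical [A]"
  by (simp add: canonical_def)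

lemma canonical_Cons_Cons:
  "canonical (A # B # z) \<longleftrightarrow> (A, B) \<notin> forward_dep \<and> canonical (B # z)" (is "?L \<longleftrightarrow> ?R")
proof
  assume ?L
  then have c: "1 \<le> i \<Longrightarrow> i < length (A # B # z) \<Longrightarrow> ((A # B # z) ! (i - 1), (A # B # z) ! i) \<notin> forward_dep"
    for i by (simp add: canonical_def)
  have "((B # z) ! (i - 1), (B # z) ! i) \<notin> forward_dep" if "1 \<le> i" "i < length (B # z)" for i
    using c[of "Suc i"] that by simp
  with c[of 1] show ?R by (auto simp: canonical_def)
next
  assume R: ?R
  have "((A # B # z) ! (i - 1), (A # B # z) ! i) \<notin> forward_dep"
    if "1 \<le> i" "i < length (A # B # z)" for i
  proof (cases "i = 1")
    case False
    with that obtain j where "i = Suc j" "1 \<le> j" by (cases i) auto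
    with that R show ?thesis by (auto simp: canonical_def)
  qed (use R in simp)
  then show ?L by (simp add: canonical_def)
qed

text \<open>List induction matches the two rules: a dependency at the first pair is a redex for
  \<open>head\<close>, one further right is reached by \<open>tail\<close>.\<close>

lemma canonical_iff_normal_form: "x \<in> step_seqs \<Longrightarrow> canonical x \<longleftrightarrow> (\<forall>y. \<not> merge x y)"
proof (induction x rule: induct_list012)
  case 1
  show ?case by (auto simp: canonical_Nil elim: merge_NilE)
next
  case (2 A)
  have "\<not> merge [A] y" for y by (auto elim: merge_ConsE merge_NilE)
  then show ?case by (simp add: canonical_single)
next
  case (3 A B z)
  have "(\<exists>y. merge (A # B # z) y) \<longleftrightarrow> (A, B) \<in> forward_dep \<or> (\<exists>y. merge (B # z) y)"
  proof
    assume "\<exists>y. merge (A # B # z) y"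
    then obtain y where "merge (A # B # z) y" ..
    then show "(A, B) \<in> forward_dep \<or> (\<exists>y. merge (B # z) y)"
      by cases (auto simp: forward_dep_def)
  next
    assume "(A, B) \<in> forward_dep \<or> (\<exists>y. merge (B # z) y)"
    then show "\<exists>y. merge (A # B # z) y"
    proof
      assume "(A, B) \<in> forward_dep"
      moreover have "z \<in> step_seqs" using 3(3) by simp
      ultimately show ?thesis by (metis forward_dep_merge)
    next
      assume "\<exists>y. merge (B # z) y"
      with 3(3) show ?thesis by (auto intro: merge.tail)
    qed
  qed
  with 3 show ?case by (auto simp: canonical_Cons_Cons)
qed

lemma merge_canonical_form:
  assumes "x \<in> step_seqs"
  obtains y where "merge\<^sup>*\<^sup>* x y" "canonical y"
proof -
  from assms have "\<exists>y. merge\<^sup>*\<^sup>* x y \<and> canonical y"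
  proof (induction x rule: wfp_induct_rule[OF wfP_merge])
    case (1 x)
    show ?case
    proof (cases "canonical x")
      case False
      with 1 obtain x' where "merge x x'" by (auto simp: canonical_iff_normal_form)
      with 1 merge_step_seqs show ?thesis
        by (metis conversep_iff converse_rtranclp_into_rtranclp)
    qed blast
  qed
  with that show thesis by blast
qed

text \<open>A common reduct of \<open>x\<close> and the normal form \<open>u\<close> can only be
  \<open>u\<close> itself.\<close>

lemma cong_canonical_merge:
  assumes "x \<approx> u" "u \<in> step_seqs" "canonical u"
  shows "merge\<^sup>*\<^sup>* x u"
  using cong_joinable[OF assms(1)] assms(2,3)
  by (metis canonical_iff_normal_form converse_rtranclpE)

lemma canonical_length_le:
  "\<lbrakk>x \<approx> u; u \<in> step_seqs; canonical u\<rbrakk> \<Longrightarrow> length u \<le> length x"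
  by (rule merge_rtranclp_length) (rule cong_canonical_merge)

text \<open>\<open>B # y\<close> rewrites to \<open>A # z\<close>, and rewriting only enlarges the
  first step. Inclusion is stronger than the bound on cardinalities in
  \<open>max_conc_at\<close>.\<close>

lemma canonical_hd_greatest:
  "\<lbrakk>B # y \<approx> A # z; A # z \<in> step_seqs; canonical (A # z)\<rbrakk> \<Longrightarrow> B \<subseteq> A"
  using merge_rtranclp_hd[OF cong_canonical_merge] by blast

section \<open>Maximal concurrency and canonicity\<close>

lemma canonical_max_conc_at_1:
  assumes "x \<in> step_seqs" "canonical x" "x \<noteq> []"
  shows "max_conc_at x 1"
proof -
  from assms(3) obtain A z where x: "x = A # z" by (cases x) auto
  with assms show ?thesis
    using canonical_hd_greatest[of _ _ A z]
    by (auto simp: max_conc_at_def intro!: card_mono finite_step)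
qed

text \<open>The last suffix is a single step, hence canonical, so position \<open>length x\<close>
  qualifies and the \<open>LEAST\<close> in \<open>mc\<close> is attained.\<close>

lemma mc_properties:
  assumes "x \<in> step_seqs" "x \<noteq> []"
  shows "1 \<le> mc x \<and> max_conc_at x (mc x)"
proof -
  have last: "drop (length x - 1) x = [x ! (length x - 1)]"
    using assms(2) by (simp add: Cons_nth_drop_Suc[symmetric])
  have "[x ! (length x - 1)] \<in> step_seqs"
    using assms by (auto simp: in_lists_conv_set)
  from canonical_max_conc_at_1[OF this canonical_single]
  have "max_conc_at x (length x)"
    using last by (simp add: max_conc_at_def)
  then show ?thesis
    unfolding mc_def
    using assms(2) LeastI[of "\<lambda>i. 1 \<le> i \<and> i \<le> length x \<and> max_conc_at x i" "length x"]
    by (auto simp: Suc_le_eq)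
qed

lemma canonical_mc:
  assumes "x \<in> step_seqs" "canonical x" "x \<noteq> []"
  shows "mc x = 1"
  unfolding mc_def using assms canonical_max_conc_at_1[OF assms]
  by (intro Least_equality) (auto simp: Suc_le_eq)

lemma canonical_drop: "canonical u \<Longrightarrow> canonical (drop n u)"
  unfolding canonical_def
proof (intro allI impI)
  fix i
  assume c: "\<forall>i. 1 \<le> i \<and> i < length u \<longrightarrow> (u ! (i - 1), u ! i) \<notin> forward_dep"
    and i: "1 \<le> i \<and> i < length (drop n u)"
  then have "n + i - 1 = n + (i - 1)" "1 \<le> n + i" "n + i < length u" by auto
  with c[rule_format, of "n + i"] i show "(drop n u ! (i - 1), drop n u ! i) \<notin> forward_dep"
    by simp
qed

lemma canonical_maximally_concurrent:
  assumes u: "u \<in> step_seqs" and c: "canonical u"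
  shows "maximally_concurrent u"
  unfolding maximally_concurrent_def
proof (intro conjI ballI impI)
  fix v assume "v \<approx> u"
  with u c show "length u \<le> length v" by (intro canonical_length_le)
next
  fix i w
  assume i: "i \<in> {1..length u}" and w: "w \<in> step_seqs"
    and cl: "drop (i - 1) u \<approx> w \<and> length (drop (i - 1) u) = length w"
  have "drop (i - 1) u \<in> step_seqs" using u by (auto dest: in_set_dropD)
  moreover have ne: "drop (i - 1) u \<noteq> []" using i by auto
  ultimately have "mc (drop (i - 1) u) = 1" using c by (intro canonical_mc canonical_drop)
  \<comment> \<open>The value of \<open>mc\<close> on the empty sequence is unspecified, so this
    case has to be excluded.\<close>
  moreover have "w \<noteq> []" using cl ne by auto
  ultimately show "mc (drop (i - 1) u) \<le> mc w" using mc_properties[OF w] by simp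
qed

text \<open>Replacing the suffix by its canonical form \<open>v\<close> gives a sequence congruent
  to \<open>u\<close>, so minimality of \<open>length u\<close> forces \<open>v\<close> to be as
  long as the suffix. Then \<open>v\<close> is admissible in the second condition, and
  \<open>mc v = 1\<close>.\<close>

lemma maximally_concurrent_drop:
  assumes u: "u \<in> step_seqs" and m: "maximally_concurrent u" and n: "n < length u"
  shows "max_conc_at (drop n u) 1"
proof -
  let ?x = "drop n u"
  have x: "?x \<in> step_seqs" "?x \<noteq> []" using u n by (auto dest: in_set_dropD)
  obtain v where v: "merge\<^sup>*\<^sup>* ?x v" "canonical v" using merge_canonical_form[OF x(1)] .
  have vs: "v \<in> step_seqs" using v(1) x(1) by (rule merge_rtranclp_step_seqs)
  have xv: "?x \<approx> v" using v(1) by (rule merge_rtranclp_cong)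
  have t: "take n u \<in> step_seqs" using u by (auto dest: in_set_takeD)
  have "take n u @ v \<approx> u" using cong_append[OF t cong_sym[OF xv]] by simp
  moreover have "take n u @ v \<in> step_seqs" using t vs by simp
  ultimately have "length u \<le> length (take n u @ v)"
    using m unfolding maximally_concurrent_def by blast
  then have len: "length ?x = length v"
    using merge_rtranclp_length[OF v(1)] n by simp
  then have "v \<noteq> []" using x(2) by auto
  have "mc ?x \<le> mc v"
    using m n vs xv len unfolding maximally_concurrent_def
    \<comment> \<open>Positions count from 1, so \<open>drop n u\<close> belongs to position
      \<open>Suc n\<close>.\<close>
    by (auto dest!: bspec[of _ _ "Suc n"])
  also have "mc v = 1" using vs v(2) \<open>v \<noteq> []\<close> by (rule canonical_mc)
  finally have "mc ?x = 1" using mc_properties[OF x] by simp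
  then show ?thesis using mc_properties[OF x] by simp
qed

lemma maximally_concurrent_canonical:
  assumes u: "u \<in> step_seqs" and m: "maximally_concurrent u"
  shows "canonical u"
  unfolding canonical_def
proof (intro allI impI notI)
  fix i
  assume i: "1 \<le> i \<and> i < length u" and fd: "(u ! (i - 1), u ! i) \<in> forward_dep"
  have x: "drop (i - 1) u = u ! (i - 1) # u ! i # drop (Suc i) u"
    using i Cons_nth_drop_Suc[of "i - 1" u] Cons_nth_drop_Suc[of i u] less_imp_diff_less[of i]
    by simp
  have "drop (Suc i) u \<in> step_seqs" using u by (auto dest: in_set_dropD)
  with fd obtain A' y where A': "u ! (i - 1) \<subset> A'" "A' \<in> steps" "y \<in> step_seqs"
      "merge (drop (i - 1) u) (A' # y)"
    unfolding x by (rule forward_dep_merge)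
  \<comment> \<open>The sequence \<open>A' # y\<close> is congruent to this suffix but has a larger
    first step.\<close>
  have "max_conc_at (drop (i - 1) u) 1" using u m i by (intro maximally_concurrent_drop) auto
  moreover have "drop (i - 1) u ! 0 = u ! (i - 1)" unfolding x by simp
  ultimately have "card A' \<le> card (u ! (i - 1))"
    using A'(2,3) cong_sym[OF merge_cong[OF A'(4)]] by (auto simp: max_conc_at_def)
  moreover have "card (u ! (i - 1)) < card A'"
    using A' by (intro psubset_card_mono finite_step)
  ultimately show False by simp
qed

end

theorem theorem8p4:
  fixes E :: "'a set" and sim ser :: "('a \<times> 'a) set" and u :: "'a set list"
  assumes "comtrace_alphabet E sim ser"
    and "u \<in> lists (comtrace_alphabet.steps E sim)"
  shows "comtrace_alphabet.maximally_concurrent E sim ser u \<longleftrightarrow>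
         comtrace_alphabet.canonical E sim ser u"
proof -
  interpret comtrace_alphabet E sim ser by fact
  show ?thesis
    using assms(2) canonical_maximally_concurrent maximally_concurrent_canonical by blast
qed

end
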